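(* Let $X$ and $Y$ be bounded distributive lattices and let $n\geqslant 1$ be an integer. A function $f\colon X^n\to Y$ is a quasi-polynomial function if and only if it is a quasi-Sugeno integral.
   Context: $X$ and $Y$ are arbitrary, possibly different, bounded distributive lattices, with operations $\wedge,\vee$ and least and greatest elements denoted $0$ and $1$ (in either lattice). Write $[n]=\{1,\ldots,n\}$ and $\mathrm{med}(a,b,c)=(a\wedge b)\vee(b\wedge c)\vee(c\wedge a)$. A (lattice) polynomial function $p\colon Y^n\to Y$ is any map which can be obtained as a composition of the lattice operations $\wedge$ and $\vee$, the projections $\mathbf{y}\mapsto y_i$ ($i\in[n]$), and the constant functions $\mathbf{y}\mapsto c$ ($c\in Y$). A (discrete) Sugeno integral is a polynomial function $p\colon Y^n\to Y$ whose range is all of $Y$ (equivalently, $p(0,\ldots,0)=0$ and $p(1,\ldots,1)=1$). A function $f\colon X^n\to Y$ is a quasi-polynomial function (resp. a quasi-Sugeno integral) if there exist a polynomial function (resp. a Sugeno integral) $p\colon Y^n\to Y$ and a unary function $\varphi\colon X\to Y$ satisfying $\varphi(x)=\mathrm{med}(\varphi(0),\varphi(x),\varphi(1))$ for every $x\in X$, such that $f(x_1,\ldots,x_n)=p(\varphi(x_1),\ldots,\varphi(x_n))$ for all $x_1,\ldots,x_n\in X$. *)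

theory Defs
  imports "HOL-Analysis.Finite_Cartesian_Product"
begin

definition med :: "'a::lattice \<Rightarrow> 'a \<Rightarrow> 'a \<Rightarrow> 'a" where
  "med a b c = sup (sup (inf a b) (inf b c)) (inf c a)"

inductive lattice_polynomial ::
  "('y::{distrib_lattice, bounded_lattice} ^ 'n \<Rightarrow> 'y) \<Rightarrow> bool" where
  proj: "lattice_polynomial (\<lambda>y. y $ i)"
| const: "lattice_polynomial (\<lambda>y. c)"
| inf: "lattice_polynomial p \<Longrightarrow> lattice_polynomial q \<Longrightarrow> lattice_polynomial (\<lambda>y. inf (p y) (q y))"
| sup: "lattice_polynomial p \<Longrightarrow> lattice_polynomial q \<Longrightarrow> lattice_polynomial (\<lambda>y. sup (p y) (q y))"

definition sugeno_integral ::
  "('y::{distrib_lattice, bounded_lattice} ^ 'n \<Rightarrow> 'y) \<Rightarrow> bool" where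
  "sugeno_integral p \<longleftrightarrow> lattice_polynomial p \<and> range p = UNIV"

definition quasi_polynomial ::
  "('x::{distrib_lattice, bounded_lattice} ^ 'n \<Rightarrow> 'y::{distrib_lattice, bounded_lattice}) \<Rightarrow> bool" where
  "quasi_polynomial f \<longleftrightarrow>
    (\<exists>(p :: 'y ^ 'n \<Rightarrow> 'y) (\<phi> :: 'x \<Rightarrow> 'y).
      lattice_polynomial p \<and>
      (\<forall>x. \<phi> x = med (\<phi> bot) (\<phi> x) (\<phi> top)) \<and>
      (\<forall>x. f x = p (\<chi> i. \<phi> (x $ i))))"

definition quasi_sugeno_integral ::
  "('x::{distrib_lattice, bounded_lattice} ^ 'n \<Rightarrow> 'y::{distrib_lattice, bounded_lattice}) \<Rightarrow> bool" where
  "quasi_sugeno_integral f \<longleftrightarrow>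
    (\<exists>(p :: 'y ^ 'n \<Rightarrow> 'y) (\<phi> :: 'x \<Rightarrow> 'y).
      sugeno_integral p \<and>
      (\<forall>x. \<phi> x = med (\<phi> bot) (\<phi> x) (\<phi> top)) \<and>
      (\<forall>x. f x = p (\<chi> i. \<phi> (x $ i))))"

end

theory Submission
  imports Defs
begin

text \<open>
  A Sugeno integral is a polynomial function, so only one direction has content.  Let
  \<open>f = p \<circ> \<phi>\<close> with a polynomial \<open>p\<close>, and put \<open>a = p(0,\<dots>,0)\<close>, \<open>b = p(1,\<dots>,1)\<close>.  All values of \<open>p\<close>
  lie between \<open>a\<close> and \<open>b\<close>, and \<open>p\<close> does not see what its arguments do outside this interval:
  truncating every argument by the lattice endomorphism \<open>h(y) = a \<or> (b \<and> y)\<close> leaves the value of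
  \<open>p\<close> unchanged (\<open>lattice_polynomial_truncate\<close>).  Hence \<open>f = p \<circ> (h \<circ> \<phi>)\<close>, and \<open>h \<circ> \<phi>\<close> inherits the
  median condition because \<open>h\<close> preserves medians.

  It remains to make \<open>p\<close> idempotent.  Bounding it by the minimum and the maximum of the
  arguments, \<open>q(z) = (p(z) \<or> \<And>z\<^sub>i) \<and> \<Or>z\<^sub>i\<close>, gives a polynomial with \<open>q(c,\<dots>,c) = c\<close>,
  thus a Sugeno integral.  This changes nothing on tuples \<open>z\<close> with entries in \<open>[a,b]\<close>, since there
  \<open>\<And>z\<^sub>i \<le> p(z) \<le> \<Or>z\<^sub>i\<close>.

  The truncation and the last bounds both rest on the fact that the relations
  \<open>x \<or> u = y \<or> u\<close> and \<open>x \<and> u = y \<and> u\<close> are lattice congruences, hence are respected by polynomials.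
\<close>

text \<open>In a distributive lattice \<open>x \<or> u = y \<or> u\<close> defines a congruence in \<open>x\<close> and \<open>y\<close>, and every
  congruence is respected by polynomial functions.\<close>
lemma lattice_polynomial_sup_cong:
  assumes "lattice_polynomial p" and "\<And>i. sup (y $ i) u = sup (z $ i) u"
  shows "sup (p y) u = sup (p z) u"
  using assms(1)
proof induction
  case (proj i)
  show ?case by (rule assms(2))
next
  case (inf p q)
  then show ?case by (simp add: sup_inf_distrib2)
next
  case (sup p q)
  have "sup (sup (p v) (q v)) u = sup (sup (p v) u) (sup (q v) u)" for v
    by (simp add: ac_simps)
  then show ?case using sup.IH by simp
qed simp

lemma lattice_polynomial_inf_cong:
  assumes "lattice_polynomial p" and "\<And>i. inf (y $ i) u = inf (z $ i) u"
  shows "inf (p y) u = inf (p z) u"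
  using assms(1)
proof induction
  case (proj i)
  show ?case by (rule assms(2))
next
  case (inf p q)
  have "inf (inf (p v) (q v)) u = inf (inf (p v) u) (inf (q v) u)" for v
    by (simp add: ac_simps)
  then show ?case using inf.IH by simp
next
  case (sup p q)
  then show ?case by (simp add: inf_sup_distrib2)
qed simp

lemma lattice_polynomial_mono:
  assumes "lattice_polynomial p" and "\<And>i. y $ i \<le> z $ i"
  shows "p y \<le> p z"
  using assms(1)
proof induction
  case (proj i)
  show ?case by (rule assms(2))
next
  case (inf p q)
  then show ?case by (intro inf_mono)
next
  case (sup p q)
  then show ?case by (intro sup_mono)
qed simp

lemma lattice_polynomial_ge_bot:
  assumes "lattice_polynomial p"
  shows "p (\<chi> i. bot) \<le> p y"
  by (rule lattice_polynomial_mono[OF assms]) simp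

lemma lattice_polynomial_le_top:
  assumes "lattice_polynomial p"
  shows "p y \<le> p (\<chi> i. top)"
  by (rule lattice_polynomial_mono[OF assms]) simp

text \<open>The value at the truncated tuple agrees with \<open>p y\<close> after joining with \<open>a = p(0,\<dots>,0)\<close>
  and meeting with \<open>b = p(1,\<dots>,1)\<close>; as both values lie in \<open>[a,b]\<close>, they coincide.\<close>
lemma lattice_polynomial_truncate:
  assumes "lattice_polynomial p"
  shows "p (\<chi> i. sup (p (\<chi> i. bot)) (inf (p (\<chi> i. top)) (y $ i))) = p y"
    (is "p (\<chi> i. sup ?a (inf ?b (y $ i))) = p y")
proof -
  have join: "p v = p w" if "\<And>i. sup (v $ i) ?a = sup (w $ i) ?a" for v w
    using lattice_polynomial_sup_cong[OF assms that]
    by (simp add: sup_absorb1 lattice_polynomial_ge_bot[OF assms])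
  have meet: "p v = p w" if "\<And>i. inf (v $ i) ?b = inf (w $ i) ?b" for v w
    using lattice_polynomial_inf_cong[OF assms that]
    by (simp add: inf_absorb1 lattice_polynomial_le_top[OF assms])
  have "p (\<chi> i. sup ?a (inf ?b (y $ i))) = p (\<chi> i. inf ?b (y $ i))"
    by (rule join) (simp add: ac_simps)
  also have "\<dots> = p y"
    by (rule meet) (simp add: ac_simps)
  finally show ?thesis .
qed

text \<open>Relative to the congruence \<open>x \<and> m = y \<and> m\<close> every \<open>z\<^sub>i \<ge> m\<close> is the same as \<open>1\<close>, so \<open>p z \<and> m\<close>
  is \<open>p(1,\<dots>,1) \<and> m\<close>.\<close>
lemma lattice_polynomial_lower_bound:
  assumes "lattice_polynomial p" and "\<And>i. m \<le> z $ i" and "m \<le> p (\<chi> i. top)"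
  shows "m \<le> p z"
proof -
  have "inf (p z) m = inf (p (\<chi> i. top)) m"
    by (rule lattice_polynomial_inf_cong[OF assms(1)]) (simp add: inf_absorb2 assms(2))
  also have "\<dots> = m"
    using assms(3) by (rule inf_absorb2)
  finally show ?thesis
    by (simp add: le_iff_inf inf_commute)
qed

lemma lattice_polynomial_upper_bound:
  assumes "lattice_polynomial p" and "\<And>i. z $ i \<le> m" and "p (\<chi> i. bot) \<le> m"
  shows "p z \<le> m"
proof -
  have "sup (p z) m = sup (p (\<chi> i. bot)) m"
    by (rule lattice_polynomial_sup_cong[OF assms(1)]) (simp add: sup_absorb2 assms(2))
  also have "\<dots> = m"
    using assms(3) by (rule sup_absorb2)
  finally show ?thesis
    by (simp add: le_iff_sup)
qed

lemma lattice_polynomial_Inf_fin: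
  assumes "finite I" and "I \<noteq> {}"
  shows "lattice_polynomial (\<lambda>y. Inf_fin ((\<lambda>i. y $ i) ` I))"
  using assms by (induction rule: finite_ne_induct) (simp_all add: lattice_polynomial.intros)

lemma lattice_polynomial_Sup_fin:
  assumes "finite I" and "I \<noteq> {}"
  shows "lattice_polynomial (\<lambda>y. Sup_fin ((\<lambda>i. y $ i) ` I))"
  using assms by (induction rule: finite_ne_induct) (simp_all add: lattice_polynomial.intros)

text \<open>Bounding a polynomial by the minimum and the maximum of its arguments makes it idempotent,
  and an idempotent polynomial function is onto.\<close>
lemma sugeno_integral_clamp:
  fixes p :: "'y::{distrib_lattice, bounded_lattice} ^ 'n \<Rightarrow> 'y"
  assumes "lattice_polynomial p"
  shows "sugeno_integral (\<lambda>z. inf (sup (p z) (Inf_fin (range (($) z)))) (Sup_fin (range (($) z))))"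
    (is "sugeno_integral ?q")
proof -
  have "lattice_polynomial ?q"
    by (intro lattice_polynomial.inf lattice_polynomial.sup assms
        lattice_polynomial_Inf_fin lattice_polynomial_Sup_fin) simp_all
  moreover have "range ?q = UNIV"
  proof (rule surjI)
    fix c :: 'y
    have "range (($) (\<chi> i::'n. c)) = {c}" by auto
    then show "?q (\<chi> i. c) = c" by (simp add: inf_absorb2)
  qed
  ultimately show ?thesis unfolding sugeno_integral_def ..
qed

text \<open>The truncation is a lattice endomorphism, by distributivity.\<close>
lemma med_truncate:
  fixes a b :: "'y::distrib_lattice"
  shows "sup a (inf b (med x y z)) =
    med (sup a (inf b x)) (sup a (inf b y)) (sup a (inf b z))"
proof -
  have "sup a (inf b (inf x y)) = inf (sup a (inf b x)) (sup a (inf b y))" for x y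
    by (simp add: sup_inf_distrib1[symmetric] ac_simps)
  moreover have "sup a (inf b (sup x y)) = sup (sup a (inf b x)) (sup a (inf b y))" for x y
    by (simp add: inf_sup_distrib1 ac_simps)
  ultimately show ?thesis unfolding med_def by simp
qed

theorem proposition11:
  fixes f :: "'x::{distrib_lattice, bounded_lattice} ^ 'n \<Rightarrow> 'y::{distrib_lattice, bounded_lattice}"
  shows "quasi_polynomial f \<longleftrightarrow> quasi_sugeno_integral f"
proof
  assume "quasi_sugeno_integral f"
  then show "quasi_polynomial f"
    unfolding quasi_sugeno_integral_def quasi_polynomial_def sugeno_integral_def by blast
next
  assume "quasi_polynomial f"
  then obtain p :: "'y ^ 'n \<Rightarrow> 'y" and \<phi> :: "'x \<Rightarrow> 'y"
    where p: "lattice_polynomial p"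
      and med: "\<And>x. \<phi> x = med (\<phi> bot) (\<phi> x) (\<phi> top)"
      and f: "\<And>x. f x = p (\<chi> i. \<phi> (x $ i))"
    unfolding quasi_polynomial_def by blast
  define a where "a = p (\<chi> i. bot)"
  define b where "b = p (\<chi> i. top)"
  define \<psi> where "\<psi> x = sup a (inf b (\<phi> x))" for x
  define q where
    "q z = inf (sup (p z) (Inf_fin (range (($) z)))) (Sup_fin (range (($) z)))" for z
  have "a \<le> b"
    unfolding a_def b_def by (rule lattice_polynomial_ge_bot[OF p])
  then have \<psi>_bounds: "a \<le> \<psi> x" "\<psi> x \<le> b" for x
    by (simp_all add: \<psi>_def)
  have "sugeno_integral q"
    unfolding q_def by (rule sugeno_integral_clamp[OF p])
  moreover have "\<psi> x = med (\<psi> bot) (\<psi> x) (\<psi> top)" for x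
    unfolding \<psi>_def med_truncate[symmetric] med[symmetric] ..
  moreover have "f x = q (\<chi> i. \<psi> (x $ i))" for x
  proof -
    let ?z = "\<chi> i. \<psi> (x $ i)"
    let ?min = "Inf_fin (range (($) ?z))" and ?max = "Sup_fin (range (($) ?z))"
    have min: "?min \<le> ?z $ i" and max: "?z $ i \<le> ?max" for i
      by (rule Inf_fin.coboundedI Sup_fin.coboundedI; simp)+
    \<comment> \<open>Any single coordinate links the minimum to \<open>b\<close> and the maximum to \<open>a\<close>; this is where
      the arity being positive matters.\<close>
    have "?min \<le> b" and "a \<le> ?max"
      using order_trans[OF min] order_trans[OF _ max] \<psi>_bounds by simp_all
    then have "?min \<le> p ?z" and "p ?z \<le> ?max"
      using lattice_polynomial_lower_bound[OF p min] lattice_polynomial_upper_bound[OF p max]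
      by (simp_all add: a_def b_def)
    then have "q ?z = p ?z"
      by (simp add: q_def sup_absorb1 inf_absorb1)
    also have "\<dots> = f x"
      using lattice_polynomial_truncate[OF p, of "\<chi> i. \<phi> (x $ i)"]
      by (simp add: f \<psi>_def a_def b_def)
    finally show ?thesis ..
  qed
  ultimately show "quasi_sugeno_integral f"
    unfolding quasi_sugeno_integral_def by blast
qed

end
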